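(* Let $C$ be a $d$-variate Archimedean copula with generator $\phi$ and let $(U_1,\ldots,U_d)$ have distribution function $C$. If the limit $$\theta_1:=-\lim_{s\downarrow 0}\frac{s\,\phi'(1-s)}{\phi(1-s)}$$ exists in $[1,\infty]$, then for every $I\subset\{1,\ldots,d\}$ with $|I|\geq 2$ and every $(x_i)_{i\in I}\in(0,\infty)^{|I|}$, $$\lim_{s\downarrow 0}s^{-1}\Pr[\forall i\in I: U_i\geq 1-s x_i]=\begin{cases}0 & \text{if }\theta_1=1,\\ \displaystyle\sum_{\varnothing\neq J\subset I}(-1)^{|J|-1}\Bigl(\sum_{i\in J}x_i^{\theta_1}\Bigr)^{1/\theta_1} & \text{if }1<\theta_1<\infty,\\ \bigwedge_{i\in I}x_i & \text{if }\theta_1=\infty.\end{cases}$$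
   Context: Fix an integer $d\geq 2$. An Archimedean generator is a convex, decreasing function $\phi:[0,1]\to[0,\infty]$ with $\phi(1)=0$; its generalized inverse is $\phi^{\leftarrow}(y)=\inf\{t\in[0,1]:\phi(t)\leq y\}$ for $y\in[0,\infty]$. The Archimedean copula with generator $\phi$ is $C(u_1,\ldots,u_d)=\phi^{\leftarrow}(\phi(u_1)+\cdots+\phi(u_d))$ on $[0,1]^d$; it is assumed throughout that $C$ is indeed a copula, i.e. (the restriction to $[0,1]^d$ of) a distribution function with uniform$(0,1)$ margins (equivalently, $\phi^{\leftarrow}$ is $d$-monotone on $(0,\infty)$). $\phi'$ denotes a non-decreasing version of the Radon-Nikodym derivative of $\phi$. $\bigwedge$ denotes minimum. *)

theory Defs
  imports "HOL-Probability.Probability"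
begin

text \<open>Only the values on the interval from 0 to 1 matter. The library's \<open>convex_on\<close> is for
  real-valued functions; here the value \<open>\<infinity>\<close> is allowed, with \<open>0 * \<infinity> = 0\<close> in \<open>ereal\<close>.
  Monotonicity is taken in the weak sense.\<close>

definition archimedean_generator :: "(real \<Rightarrow> ereal) \<Rightarrow> bool" where
  "archimedean_generator \<phi> \<longleftrightarrow>
     (\<forall>t\<in>{0..1}. 0 \<le> \<phi> t) \<and>
     (\<forall>a\<in>{0..1}. \<forall>b\<in>{0..1}. \<forall>t\<in>{0..1}.
        \<phi> ((1 - t) * a + t * b) \<le> ereal (1 - t) * \<phi> a + ereal t * \<phi> b) \<and>
     antimono_on {0..1} \<phi> \<and>
     \<phi> 1 = 0"

definition generalized_inverse :: "(real \<Rightarrow> ereal) \<Rightarrow> ereal \<Rightarrow> real" where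
  "generalized_inverse \<phi> y = Inf {t \<in> {0..1}. \<phi> t \<le> y}"

text \<open>A point of the \<open>d\<close>-dimensional unit cube is a function \<open>u\<close> on the naturals, of which only
  the values at \<open>1, \<dots>, d\<close> are used.\<close>

definition archimedean_function :: "nat \<Rightarrow> (real \<Rightarrow> ereal) \<Rightarrow> (nat \<Rightarrow> real) \<Rightarrow> real" where
  "archimedean_function d \<phi> u = generalized_inverse \<phi> (\<Sum>i\<in>{1..d}. \<phi> (u i))"

text \<open>The random vector \<open>(U 1, \<dots>, U d)\<close> on \<open>M\<close> has a distribution function that restricts to
  \<open>C\<close> on the unit cube. If \<open>C\<close> is a copula, this determines the law of the vector, since
  then almost surely all its components lie in the unit interval.\<close>

definition has_distribution_function ::
    "'a measure \<Rightarrow> nat \<Rightarrow> (nat \<Rightarrow> 'a \<Rightarrow> real) \<Rightarrow> ((nat \<Rightarrow> real) \<Rightarrow> real) \<Rightarrow> bool" where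
  "has_distribution_function M d U C \<longleftrightarrow>
     (\<forall>i\<in>{1..d}. U i \<in> borel_measurable M) \<and>
     (\<forall>u \<in> {1..d} \<rightarrow> {0..1}. \<P>(\<omega> in M. \<forall>i\<in>{1..d}. U i \<omega> \<le> u i) = C u)"

definition copula :: "nat \<Rightarrow> ((nat \<Rightarrow> real) \<Rightarrow> real) \<Rightarrow> bool" where
  "copula d C \<longleftrightarrow>
     (\<exists>P. prob_space P \<and> sets P = sets (\<Pi>\<^sub>M i\<in>{1..d}. (borel :: real measure)) \<and>
          has_distribution_function P d (\<lambda>i v. v i) C \<and>
          (\<forall>i\<in>{1..d}. distr P borel (\<lambda>v. v i) = uniform_measure lborel {0<..<1}))"

text \<open>\<open>\<phi>'\<close> is a non-decreasing version of the Radon-Nikodym derivative of \<open>\<phi>\<close>. The intervals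
  stay away from \<open>0\<close>, where \<open>\<phi>\<close> may be infinite or have a jump. The equation in \<open>ereal\<close> forces
  \<open>\<phi>\<close> to be finite on all of them.\<close>

definition nondecreasing_derivative :: "(real \<Rightarrow> ereal) \<Rightarrow> (real \<Rightarrow> real) \<Rightarrow> bool" where
  "nondecreasing_derivative \<phi> \<phi>' \<longleftrightarrow>
     mono_on {0<..<1} \<phi>' \<and>
     (\<forall>a b. 0 < a \<longrightarrow> a \<le> b \<longrightarrow> b \<le> 1 \<longrightarrow>
        set_integrable lborel {a..b} \<phi>' \<and> \<phi> b - \<phi> a = ereal (LBINT t:{a..b}. \<phi>' t))"

end

theory Submission
  imports Defs "HOL-Real_Asymp.Real_Asymp"
begin

text \<open>Put \<open>f(s) = \<phi>(1 - s)\<close>. The hypothesis on \<open>\<theta>\<^sub>1\<close> makes \<open>f\<close> regularly varying at \<open>0\<close> with index \<open>\<theta>\<^sub>1\<close>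
  (rapidly varying if \<open>\<theta>\<^sub>1 = \<infinity>\<close>). Comparing \<open>\<Sum>\<^sub>i f(s x\<^sub>i)\<close> with \<open>f(c s)\<close> for constants \<open>c\<close> shows that
  \<open>Pr[\<exists>i\<in>J. U\<^sub>i > 1 - s x\<^sub>i] / s\<close> tends to the \<open>\<theta>\<^sub>1\<close>-norm of \<open>x\<close> on \<open>J\<close>, which is the maximum if \<open>\<theta>\<^sub>1 = \<infinity>\<close>.
  The theorem follows by the inclusion-exclusion formula that expresses an intersection through unions.
  Applied to singletons and to intervals instead of events, the same formula evaluates the
  alternating sum at the extreme values \<open>1\<close> and \<open>\<infinity>\<close> of \<open>\<theta>\<^sub>1\<close>.\<close>

section \<open>Inclusion-exclusion for intersections\<close>

text \<open>By induction on \<open>I\<close>: the subsets of \<open>insert k F\<close> containing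
  \<open>k\<close> contribute \<open>f (A k)\<close> minus the alternating sum for the family
  \<open>A i \<union> A k\<close>, to which the induction hypothesis applies since \<open>A\<close>
  is arbitrary. Modularity of \<open>f\<close> closes the step. Asking for additivity on a ring lets
  \<open>f\<close> be a probability, a length or a sum of weights.\<close>

lemma dual_inclusion_exclusion:
  fixes f :: "'b set \<Rightarrow> real"
  assumes "finite I" "I \<noteq> {}"
    and "ring_of_sets \<Omega> R"
    and add: "\<And>S T. S \<in> R \<Longrightarrow> T \<in> R \<Longrightarrow> S \<inter> T = {} \<Longrightarrow> f (S \<union> T) = f S + f T"
    and "\<And>i. i \<in> I \<Longrightarrow> A i \<in> R"
  shows "(\<Sum>J\<in>Pow I - {{}}. (-1) ^ (card J - 1) * f (\<Union>i\<in>J. A i)) = f (\<Inter>i\<in>I. A i)"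
  using assms(1,2,5)
proof (induction arbitrary: A rule: finite_ne_induct)
  case (singleton k)
  have "Pow {k} - {{}} = {{k}}" by auto
  then show ?case by simp
next
  case (insert k F)
  interpret ring_of_sets \<Omega> R by fact
  \<comment> \<open>Splitting off \<open>S - T\<close> from \<open>S\<close> and from
    \<open>S \<union> T\<close> and subtracting eliminates \<open>f (S - T)\<close>.\<close>
  have modular: "f (S \<inter> T) = f S + f T - f (S \<union> T)" if "S \<in> R" "T \<in> R" for S T
  proof -
    have 1: "f (S - T \<union> S \<inter> T) = f (S - T) + f (S \<inter> T)" using that by (intro add) auto
    have 2: "f ((S - T) \<union> T) = f (S - T) + f T" using that by (intro add) auto
    have "S - T \<union> S \<inter> T = S" "(S - T) \<union> T = S \<union> T" by auto
    with 1 2 show ?thesis by simp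
  qed
  have split: "Pow (insert k F) - {{}} = (Pow F - {{}}) \<union> insert k ` Pow F" by (auto simp: Pow_insert)
  have disj: "(Pow F - {{}}) \<inter> insert k ` Pow F = {}" using insert.hyps by auto
  have inj: "inj_on (insert k) (Pow F)" using insert.hyps by (auto simp: inj_on_def)
  have PF: "Pow F = insert {} (Pow F - {{}})" by auto
  \<comment> \<open>The subtraction is truncated, so the sign flips only for nonempty
    \<open>J\<close>. The empty set is therefore split off and yields the separate term
    \<open>f (A k)\<close>.\<close>
  have s: "card (insert k J) - 1 = Suc (card J - 1)" if "J \<in> Pow F - {{}}" for J
  proof -
    have "finite J" "J \<noteq> {}" "k \<notin> J" using that insert.hyps finite_subset by auto
    then show ?thesis by (simp add: card_gt_0_iff)
  qed
  let ?g = "\<lambda>J. (-1) ^ (card J - 1) * f (\<Union>i\<in>J. A i)"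
  have IntF: "(\<Inter>i\<in>F. A i) \<in> R" using insert by (intro finite_INT) auto
  have "sum ?g (Pow (insert k F) - {{}}) = sum ?g (Pow F - {{}}) + (\<Sum>J\<in>Pow F. ?g (insert k J))"
    unfolding split using disj inj insert.hyps
    by (subst sum.union_disjoint) (auto simp: sum.reindex)
  also have "(\<Sum>J\<in>Pow F. ?g (insert k J)) = f (A k) + (\<Sum>J\<in>Pow F - {{}}. ?g (insert k J))"
    using insert.hyps by (subst PF, subst sum.insert) auto
  also have "(\<Sum>J\<in>Pow F - {{}}. ?g (insert k J))
      = (\<Sum>J\<in>Pow F - {{}}. - ((-1) ^ (card J - 1) * f (\<Union>i\<in>J. A i \<union> A k)))"
  proof (rule sum.cong[OF refl])
    fix J assume J: "J \<in> Pow F - {{}}"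
    then have "(\<Union>i\<in>insert k J. A i) = (\<Union>i\<in>J. A i \<union> A k)" by auto
    then show "?g (insert k J) = - ((-1) ^ (card J - 1) * f (\<Union>i\<in>J. A i \<union> A k))"
      by (simp only: s[OF J]) simp
  qed
  also have "\<dots> = - f (\<Inter>i\<in>F. A i \<union> A k)"
    unfolding sum_negf using insert by (subst insert.IH) auto
  also have "sum ?g (Pow F - {{}}) = f (\<Inter>i\<in>F. A i)"
    using insert by (intro insert.IH) auto
  also have "(\<Inter>i\<in>F. A i \<union> A k) = (\<Inter>i\<in>F. A i) \<union> A k" by auto
  finally show ?case using modular[OF IntF, of "A k"] insert.prems by (simp add: Int_commute)
qed

text \<open>The maximum is the length of the union of the intervals \<open>{0<..x i}\<close> and the
  minimum is the length of their intersection.\<close>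

lemma alternating_sum_Max:
  fixes x :: "'i \<Rightarrow> real"
  assumes "finite I" "I \<noteq> {}" and x: "\<And>i. i \<in> I \<Longrightarrow> 0 < x i"
  shows "(\<Sum>J\<in>Pow I - {{}}. (-1) ^ (card J - 1) * Max (x ` J)) = Min (x ` I)"
proof -
  have "Max (x ` J) = measure lborel (\<Union>i\<in>J. {0<..x i})" if J: "J \<in> Pow I - {{}}" for J
  proof -
    have "finite J" "J \<noteq> {}" using J assms(1) finite_subset by auto
    then have "u \<le> Max (x ` J) \<longleftrightarrow> (\<exists>i\<in>J. u \<le> x i)" for u by (subst Max_ge_iff) auto
    then have "(\<Union>i\<in>J. {0<..x i}) = {0<..Max (x ` J)}" by auto
    moreover have "Max (x ` J) \<in> x ` J" using \<open>finite J\<close> \<open>J \<noteq> {}\<close> by (intro Max_in) auto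
    then have "0 < Max (x ` J)" using J x by auto
    ultimately show ?thesis by simp
  qed
  then have "(\<Sum>J\<in>Pow I - {{}}. (-1) ^ (card J - 1) * Max (x ` J))
      = (\<Sum>J\<in>Pow I - {{}}. (-1) ^ (card J - 1) * measure lborel (\<Union>i\<in>J. {0<..x i}))"
    by simp
  also have "\<dots> = measure lborel (\<Inter>i\<in>I. {0<..x i})"
  proof (rule dual_inclusion_exclusion[OF assms(1,2)])
    \<comment> \<open>The real-valued \<open>measure\<close> is \<open>0\<close> on sets of infinite
      measure, so additivity calls for the ring of sets of finite measure.\<close>
    show "ring_of_sets UNIV (fmeasurable (lborel :: real measure))"
      using fmeasurable.ring_of_sets_axioms[of "lborel :: real measure"] by simp
    show "measure lborel (S \<union> T) = measure lborel S + measure lborel T"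
      if "S \<in> fmeasurable lborel" "T \<in> fmeasurable lborel" "S \<inter> T = {}" for S T :: "real set"
      using that by (intro measure_Union) (auto simp: fmeasurable_def)
    show "{0<..x i} \<in> fmeasurable lborel" if "i \<in> I" for i
      using x[OF that] by (intro fmeasurableI) auto
  qed
  also have "(\<Inter>i\<in>I. {0<..x i}) = {0<..Min (x ` I)}"
  proof -
    have "u \<le> Min (x ` I) \<longleftrightarrow> (\<forall>i\<in>I. u \<le> x i)" for u using assms(1,2) by (subst Min_ge_iff) auto
    then show ?thesis using assms(2) by auto
  qed
  also have "measure lborel \<dots> = Min (x ` I)" using assms by (simp add: less_imp_le)
  finally show ?thesis .
qed

text \<open>The sum over \<open>J\<close> is an additive set function of the union of the singletons
  \<open>{i}\<close>, and the intersection of at least two distinct singletons is empty.\<close>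

lemma alternating_sum_sum:
  fixes x :: "'i \<Rightarrow> real"
  assumes "finite I" "2 \<le> card I"
  shows "(\<Sum>J\<in>Pow I - {{}}. (-1) ^ (card J - 1) * (\<Sum>i\<in>J. x i)) = 0"
proof -
  have "I \<noteq> {}" using assms(2) by auto
  have "\<exists>i j. i \<in> I \<and> j \<in> I \<and> i \<noteq> j"
    using assms card_le_Suc0_iff_eq[OF assms(1)] by force
  then have empty: "(\<Inter>i\<in>I. {i}) = {}" by auto
  have "(\<Sum>J\<in>Pow I - {{}}. (-1) ^ (card J - 1) * sum x (\<Union>i\<in>J. {i})) = sum x (\<Inter>i\<in>I. {i})"
    using assms(1) \<open>I \<noteq> {}\<close>
    by (intro dual_inclusion_exclusion[where R = "Pow I" and \<Omega> = I] ring_of_sets_Pow)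
       (auto intro!: sum.union_disjoint dest: finite_subset)
  then show ?thesis unfolding empty by simp
qed

section \<open>Power growth\<close>

text \<open>The roots of \<open>x\<close> of order \<open>n\<close> tend to \<open>1\<close> from
  above. An estimate valid for factors close to \<open>1\<close> can thus be iterated
  \<open>n\<close> times to reach the factor \<open>x\<close> exactly.\<close>

lemma ex_root_at_right_1:
  fixes x :: real
  assumes "1 < x" "eventually P (at_right 1)"
  obtains q :: real and n :: nat where "1 < q" "q ^ n = x" "P q"
proof -
  have "eventually (\<lambda>q. 1 < q \<and> P q) (at_right 1)"
    using assms(2) eventually_at_right_less by (rule eventually_conj[rotated])
  moreover have "filterlim (\<lambda>n. x powr (1 / real n)) (at_right 1) sequentially"
    using assms(1) by real_asymp
  ultimately have "eventually (\<lambda>n. 1 < x powr (1 / real n) \<and> P (x powr (1 / real n))) sequentially"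
    by (rule eventually_compose_filterlim)
  then have "eventually (\<lambda>n. (1 < x powr (1 / real n) \<and> P (x powr (1 / real n))) \<and> 0 < n) sequentially"
    by (rule eventually_conj[OF _ eventually_gt_at_top])
  then obtain n where n: "1 < x powr (1 / real n)" "P (x powr (1 / real n))" "0 < n"
    by (auto dest: eventually_happens'[OF sequentially_bot])
  moreover have "(x powr (1 / real n)) ^ n = x"
    using n(3) assms(1) by (simp add: powr_realpow[symmetric] powr_powr)
  ultimately show ?thesis using that by blast
qed

lemma filterlim_mult_at_right_0:
  fixes c :: real
  assumes "0 < c"
  shows "filterlim (\<lambda>s. c * s) (at_right 0) (at_right 0)"
  using assms by real_asymp

text \<open>Only finitely many steps are multiplied, so their ranges of validity near
  \<open>0\<close> have a common part. The sign of \<open>h\<close> is left open because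
  \<open>h\<close> is also taken to be \<open>- f\<close>.\<close>

lemma eventually_geometric_le:
  fixes h :: "real \<Rightarrow> real"
  assumes "0 < q" "0 \<le> r" and step: "eventually (\<lambda>t. r * h t \<le> h (q * t)) (at_right 0)"
  shows "eventually (\<lambda>s. r ^ n * h s \<le> h (q ^ n * s)) (at_right 0)"
proof (induction n)
  case (Suc n)
  have "eventually (\<lambda>s. r * h (q ^ n * s) \<le> h (q * (q ^ n * s))) (at_right 0)"
    using assms(1) by (intro eventually_compose_filterlim[OF step] filterlim_mult_at_right_0) simp
  with Suc show ?case
  proof eventually_elim
    case (elim s)
    have "r ^ Suc n * h s \<le> r * h (q ^ n * s)"
      using mult_left_mono[OF elim(1) assms(2)] by (simp add: mult.assoc)
    with elim(2) show ?case by (simp add: mult.assoc)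
  qed
qed simp

text \<open>The logarithmic derivative \<open>s g(s) / f(s)\<close> controls the growth of \<open>f\<close> by a power; instead of
  integrating it, one multiplies the estimates over the steps \<open>s, q s, \<dots>, q\<^sup>n s = x s\<close>.\<close>

lemma eventually_powr_mult_le:
  fixes f g :: "real \<Rightarrow> real"
  assumes incr: "\<And>a b. 0 < a \<Longrightarrow> a \<le> b \<Longrightarrow> b < 1 \<Longrightarrow> g a * (b - a) \<le> f b - f a"
    and pos: "\<And>s. 0 < s \<Longrightarrow> s < 1 \<Longrightarrow> 0 < f s"
    and ev: "eventually (\<lambda>s. c \<le> s * g s / f s) (at_right 0)"
    and c': "c' < c" and x: "1 \<le> x"
  shows "eventually (\<lambda>s. x powr c' * f s \<le> f (x * s)) (at_right 0)"
proof (cases "x = 1")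
  case False
  \<comment> \<open>Both sides equal \<open>1\<close> at \<open>q = 1\<close>, where their
    derivatives are \<open>c'\<close> and \<open>c\<close>; the gap \<open>c' < c\<close>
    decides.\<close>
  have "eventually (\<lambda>q. q powr c' \<le> 1 + c * (q - 1)) (at_right 1)"
    using c' by real_asymp
  from ex_root_at_right_1[OF _ this, of x] False x obtain q :: real and n :: nat
    where q: "1 < q" "q ^ n = x" "q powr c' \<le> 1 + c * (q - 1)"
    by auto
  have "eventually (\<lambda>t. 0 < t \<and> t < 1 / q) (at_right 0)"
    using eventually_at_right_real[of 0 "1 / q"] q(1) by simp
  with ev have "eventually (\<lambda>t. q powr c' * f t \<le> f (q * t)) (at_right 0)"
  proof eventually_elim
    case (elim t)
    then have t: "q * t < 1" "t \<le> q * t" using q(1) by (auto simp: field_simps)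
    with elim have f: "0 < f t" by (intro pos; linarith)
    have "q powr c' * f t \<le> (1 + c * (q - 1)) * f t"
      using q(3) f by (intro mult_right_mono) auto
    also have "\<dots> = f t + (c * f t) * (q - 1)" by (simp add: algebra_simps)
    also have "\<dots> \<le> f t + (t * g t) * (q - 1)"
      using elim f q(1) by (intro add_left_mono mult_right_mono) (auto simp: field_simps)
    \<comment> \<open>The interval from \<open>t\<close> to \<open>q * t\<close> has length
      \<open>(q - 1) * t\<close>, which produces the factor \<open>t * g t\<close>.\<close>
    also have "\<dots> \<le> f (q * t)"
      using incr[of t "q * t"] t elim by (simp add: algebra_simps)
    finally show ?case .
  qed
  then have "eventually (\<lambda>s. (q powr c') ^ n * f s \<le> f (q ^ n * s)) (at_right 0)"
    using q(1) by (intro eventually_geometric_le) auto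
  moreover have "(q powr c') ^ n = x powr c'"
    using q(1) by (simp add: q(2)[symmetric] powr_realpow[symmetric] powr_powr mult.commute)
  ultimately show ?thesis by (simp add: q(2))
qed simp

text \<open>The increment over one step is now bounded through \<open>g\<close> at the right
  endpoint \<open>u = q * t\<close>, which bounds \<open>f t\<close> from below by a multiple of
  \<open>f u\<close>. Written for \<open>- f\<close>, this is again an estimate that can be
  iterated.\<close>

lemma eventually_le_powr_mult:
  fixes f g :: "real \<Rightarrow> real"
  assumes incr: "\<And>a b. 0 < a \<Longrightarrow> a \<le> b \<Longrightarrow> b < 1 \<Longrightarrow> f b - f a \<le> g b * (b - a)"
    and pos: "\<And>s. 0 < s \<Longrightarrow> s < 1 \<Longrightarrow> 0 < f s"
    and ev: "eventually (\<lambda>s. s * g s / f s \<le> c) (at_right 0)"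
    and c': "c < c'" and x: "1 \<le> x"
  shows "eventually (\<lambda>s. f (x * s) \<le> x powr c' * f s) (at_right 0)"
proof (cases "x = 1")
  case False
  \<comment> \<open>Here the derivatives at \<open>q = 1\<close> are \<open>- c'\<close> and
    \<open>- c\<close>.\<close>
  have "eventually (\<lambda>q. q powr (- c') \<le> 1 - c * (1 - 1 / q)) (at_right 1)"
    using c' by real_asymp
  from ex_root_at_right_1[OF _ this, of x] False x obtain q :: real and n :: nat
    where q: "1 < q" "q ^ n = x" "q powr (- c') \<le> 1 - c * (1 - 1 / q)"
    by auto
  have "eventually (\<lambda>t. 0 < t \<and> t < 1 / q) (at_right 0)"
    using eventually_at_right_real[of 0 "1 / q"] q(1) by simp
  moreover have "eventually (\<lambda>t. q * t * g (q * t) / f (q * t) \<le> c) (at_right 0)"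
    using q(1) by (intro eventually_compose_filterlim[OF ev] filterlim_mult_at_right_0) simp
  ultimately have "eventually (\<lambda>t. q powr c' * - f t \<le> - f (q * t)) (at_right 0)"
  proof eventually_elim
    case (elim t)
    define u where "u = q * t"
    have u: "u < 1" "0 < u" "t \<le> u" "t = u / q"
      using q(1) elim by (auto simp: u_def field_simps)
    then have f: "0 < f u" by (intro pos)
    have "q powr (- c') * f u \<le> (1 - c * (1 - 1 / q)) * f u"
      using q(3) f by (intro mult_right_mono) auto
    also have "\<dots> = f u - (c * f u) * (1 - 1 / q)" by (simp add: algebra_simps)
    also have "\<dots> \<le> f u - (u * g u) * (1 - 1 / q)"
      using elim f q(1) by (intro diff_left_mono mult_right_mono) (auto simp: field_simps u_def)
    also have "\<dots> = f u - g u * (u - t)" by (simp add: u(4) algebra_simps)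
    also have "\<dots> \<le> f t"
      using incr[of t u] u elim by simp
    finally show ?case
      using q(1) by (simp add: u_def powr_minus field_simps)
  qed
  then have "eventually (\<lambda>s. (q powr c') ^ n * - f s \<le> - f (q ^ n * s)) (at_right 0)"
    using q(1) by (intro eventually_geometric_le[where h = "\<lambda>t. - f t"]) auto
  moreover have "(q powr c') ^ n = x powr c'"
    using q(1) by (simp add: q(2)[symmetric] powr_realpow[symmetric] powr_powr mult.commute)
  ultimately show ?thesis by (simp add: q(2))
qed simp

text \<open>For \<open>x \<ge> 1\<close> the ratio is squeezed between powers of \<open>x\<close>
  with exponents on either side of \<theta>, by continuity in the exponent. The case
  \<open>x < 1\<close> reduces to \<open>1 / x\<close>.\<close>

lemma tendsto_ratio_powr:
  fixes f g :: "real \<Rightarrow> real"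
  assumes incr: "\<And>a b. 0 < a \<Longrightarrow> a \<le> b \<Longrightarrow> b < 1 \<Longrightarrow> g a * (b - a) \<le> f b - f a"
      "\<And>a b. 0 < a \<Longrightarrow> a \<le> b \<Longrightarrow> b < 1 \<Longrightarrow> f b - f a \<le> g b * (b - a)"
    and pos: "\<And>s. 0 < s \<Longrightarrow> s < 1 \<Longrightarrow> 0 < f s"
    and lim: "((\<lambda>s. s * g s / f s) \<longlongrightarrow> \<theta>) (at_right 0)"
    and x: "0 < x"
  shows "((\<lambda>s. f (x * s) / f s) \<longlongrightarrow> x powr \<theta>) (at_right 0)"
proof -
  have ge1: "((\<lambda>s. f (x * s) / f s) \<longlongrightarrow> x powr \<theta>) (at_right 0)" if x: "1 \<le> x" for x
  proof (rule order_tendstoI)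
    have pos': "eventually (\<lambda>s. 0 < f s) (at_right 0)"
      using pos by (auto simp: eventually_at_right_field intro!: exI[of _ 1])
    have cont: "((\<lambda>c. x powr c) \<longlongrightarrow> x powr \<theta>) (at \<theta>)"
      using x by (intro tendsto_intros) auto
    {
      fix a assume "a < x powr \<theta>"
      with cont have "eventually (\<lambda>c. a < x powr c) (at_left \<theta>)"
        by (intro order_tendstoD(1)[of _ "x powr \<theta>"]) (auto simp: filterlim_at_split)
      then have "eventually (\<lambda>c. a < x powr c \<and> c < \<theta>) (at_left \<theta>)"
        by (intro eventually_conj eventually_at_left_real) (auto simp: eventually_at_filter)
      then obtain c' where c': "a < x powr c'" "c' < \<theta>"
        by (auto dest: eventually_happens)
      \<comment> \<open>The growth estimate loses a little in the exponent: \<open>c\<close> bounds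
        the logarithmic derivative and the smaller \<open>c'\<close> is the exponent
        obtained.\<close>
      then obtain c where c: "c' < c" "c < \<theta>" using dense by blast
      have "eventually (\<lambda>s. c \<le> s * g s / f s) (at_right 0)"
        using order_tendstoD(1)[OF lim c(2)] by (auto elim: eventually_mono)
      then have "eventually (\<lambda>s. x powr c' * f s \<le> f (x * s)) (at_right 0)"
        using incr pos c x by (intro eventually_powr_mult_le[of g f c c' x]) auto
      with pos'
      show "eventually (\<lambda>s. a < f (x * s) / f s) (at_right 0)"
      proof eventually_elim
        case (elim s)
        then have "x powr c' \<le> f (x * s) / f s" by (simp add: field_simps)
        with c'(1) show ?case by simp
      qed
    next
      fix a assume "x powr \<theta> < a"
      with cont have "eventually (\<lambda>c. x powr c < a) (at_right \<theta>)"
        by (intro order_tendstoD(2)[of _ "x powr \<theta>"]) (auto simp: filterlim_at_split)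
      then have "eventually (\<lambda>c. x powr c < a \<and> \<theta> < c) (at_right \<theta>)"
        by (intro eventually_conj) (auto simp: eventually_at_filter)
      then obtain c' where c': "x powr c' < a" "\<theta> < c'"
        by (auto dest: eventually_happens)
      then obtain c where c: "\<theta> < c" "c < c'" using dense by blast
      have "eventually (\<lambda>s. s * g s / f s \<le> c) (at_right 0)"
        using order_tendstoD(2)[OF lim c(1)] by (auto elim: eventually_mono)
      then have "eventually (\<lambda>s. f (x * s) \<le> x powr c' * f s) (at_right 0)"
        using incr pos c x by (intro eventually_le_powr_mult[of f g c c' x]) auto
      with pos'
      show "eventually (\<lambda>s. f (x * s) / f s < a) (at_right 0)"
      proof eventually_elim
        case (elim s)
        then have "f (x * s) / f s \<le> x powr c'" by (simp add: field_simps)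
        with c'(1) show ?case by simp
      qed
    }
  qed
  show ?thesis
  proof (cases "1 \<le> x")
    case False
    with x have "((\<lambda>s. f (1 / x * s) / f s) \<longlongrightarrow> (1 / x) powr \<theta>) (at_right 0)"
      by (intro ge1) auto
    \<comment> \<open>Substituting \<open>x * s\<close> for \<open>s\<close> gives the reciprocal of
      the wanted ratio.\<close>
    from filterlim_compose[OF this filterlim_mult_at_right_0[OF x]] have "((\<lambda>s. f (1 / x * (x * s)) / f (x * s)) \<longlongrightarrow> (1 / x) powr \<theta>) (at_right 0)" .
    from tendsto_inverse[OF this] show ?thesis
      using x by (simp add: powr_divide field_simps)
  qed (rule ge1)
qed

text \<open>For \<theta> at least \<open>1\<close> and positive \<open>x\<close> this is the
  \<theta>-norm of \<open>x\<close> on \<open>J\<close>, with its limit at \<theta> = \<infinity>: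
  the stable tail dependence function of the logistic (Gumbel) model.\<close>

definition logistic_tail :: "ereal \<Rightarrow> ('i \<Rightarrow> real) \<Rightarrow> 'i set \<Rightarrow> real" where
  "logistic_tail \<theta> x J =
     (if \<theta> < \<infinity> then (\<Sum>i\<in>J. x i powr real_of_ereal \<theta>) powr (1 / real_of_ereal \<theta>) else Max (x ` J))"

text \<open>An abstraction of \<open>f s = \<phi> (1 - s)\<close> and
  \<open>g s = - \<phi>' (1 - s)\<close>. Instead of differentiability, the difference quotient of
  \<open>f\<close> lies between the values of \<open>g\<close> at the endpoints.\<close>

locale power_growth =
  fixes f g :: "real \<Rightarrow> real" and \<theta> :: ereal
  assumes incr_ge: "\<And>a b. 0 < a \<Longrightarrow> a \<le> b \<Longrightarrow> b < 1 \<Longrightarrow> g a * (b - a) \<le> f b - f a"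
    and incr_le: "\<And>a b. 0 < a \<Longrightarrow> a \<le> b \<Longrightarrow> b < 1 \<Longrightarrow> f b - f a \<le> g b * (b - a)"
    and pos: "\<And>s. 0 < s \<Longrightarrow> s < 1 \<Longrightarrow> 0 < f s"
    and mono: "\<And>a b. 0 < a \<Longrightarrow> a \<le> b \<Longrightarrow> b < 1 \<Longrightarrow> f a \<le> f b"
    and index_ge_1: "1 \<le> \<theta>"
    and tendsto_index: "((\<lambda>s. ereal (s * g s / f s)) \<longlongrightarrow> \<theta>) (at_right 0)"
begin

lemma eventually_pos: "0 < x \<Longrightarrow> eventually (\<lambda>s. 0 < f (x * s)) (at_right 0)"
  by (rule eventually_compose_filterlim[OF _ filterlim_mult_at_right_0])
    (auto simp: eventually_at_right_field intro!: pos exI[of _ 1])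

lemma eventually_mult_mono:
  assumes "0 < a" "a \<le> b"
  shows "eventually (\<lambda>s. f (a * s) \<le> f (b * s)) (at_right 0)"
proof -
  have "eventually (\<lambda>s. 0 < s \<and> s < 1 / b) (at_right 0)"
    using eventually_at_right_real[of 0 "1 / b"] assms by simp
  then show ?thesis
    by eventually_elim (use assms in \<open>auto intro!: mono simp: field_simps\<close>)
qed

lemma tendsto_ratio:
  assumes "\<theta> = ereal r" "0 < x"
  shows "((\<lambda>s. f (x * s) / f s) \<longlongrightarrow> x powr r) (at_right 0)"
  using tendsto_index assms by (intro tendsto_ratio_powr[of g f] incr_ge incr_le pos) auto

text \<open>With infinite index, \<open>f\<close> grows faster than every power, so a fixed factor
  \<open>x > 1\<close> in the argument beats any constant.\<close>

lemma eventually_mult_le_if_infinite_index: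
  assumes "\<theta> = \<infinity>" "1 < x"
  shows "eventually (\<lambda>s. K * f s \<le> f (x * s)) (at_right 0)"
proof -
  \<comment> \<open>Chosen so that \<open>x powr c = max K 1\<close>; the maximum keeps the
    logarithm's argument positive, and \<open>c + 1\<close> below provides the strict gap in the
    exponent.\<close>
  define c where "c = log x (max K 1)"
  have "eventually (\<lambda>s. ereal (c + 1) < ereal (s * g s / f s)) (at_right 0)"
    using tendsto_index assms(1) by (intro order_tendstoD(1)) auto
  then have "eventually (\<lambda>s. c + 1 \<le> s * g s / f s) (at_right 0)"
    by (rule eventually_mono) simp
  then have "eventually (\<lambda>s. x powr c * f s \<le> f (x * s)) (at_right 0)"
    using assms(2) by (intro eventually_powr_mult_le[of g f "c + 1"] incr_ge pos) auto
  moreover have "eventually (\<lambda>s. 0 < f s) (at_right 0)" using eventually_pos[of 1] by simp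
  ultimately show ?thesis
  proof eventually_elim
    case (elim s)
    have "K * f s \<le> max K 1 * f s" using elim by (intro mult_right_mono) auto
    also have "max K 1 = x powr c" using assms(2) by (simp add: c_def)
    finally show ?case using elim by linarith
  qed
qed

context
  fixes J :: "'i set" and x :: "'i \<Rightarrow> real"
  assumes J: "finite J" "J \<noteq> {}" and x: "\<forall>i\<in>J. 0 < x i"
begin

lemma logistic_tail_nonneg: "0 \<le> logistic_tail \<theta> x J"
proof (cases "\<theta> < \<infinity>")
  case False
  have "Max (x ` J) \<in> x ` J" using J by (intro Max_in) auto
  with False show ?thesis using x by (force simp: logistic_tail_def)
qed (simp add: logistic_tail_def)

text \<open>Writing the limit as a power of \<open>logistic_tail\<close> reduces comparing the sum
  with \<open>f (c * s)\<close> to comparing \<open>logistic_tail\<close> with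
  \<open>c\<close>.\<close>

lemma finite_index:
  assumes "\<theta> \<noteq> \<infinity>"
  obtains r where "\<theta> = ereal r" "1 \<le> r"
    "((\<lambda>s. (\<Sum>i\<in>J. f (x i * s)) / f s) \<longlongrightarrow> logistic_tail \<theta> x J powr r) (at_right 0)"
proof -
  obtain r where r: "\<theta> = ereal r" "1 \<le> r"
    using assms index_ge_1 by (cases \<theta>) (auto simp: one_ereal_def)
  have "0 < (\<Sum>i\<in>J. x i powr r)"
    using J x by (intro sum_pos) fastforce+
  then have eq: "(\<Sum>i\<in>J. x i powr r) = logistic_tail \<theta> x J powr r"
    using r by (simp add: logistic_tail_def powr_powr)
  have "((\<lambda>s. \<Sum>i\<in>J. f (x i * s) / f s) \<longlongrightarrow> (\<Sum>i\<in>J. x i powr r)) (at_right 0)"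
    using r(1) x by (intro tendsto_sum tendsto_ratio) auto
  with that r eq show ?thesis by (simp add: sum_divide_distrib)
qed

text \<open>For finite index, both sides divided by \<open>f s\<close> have limits separated by some
  \<open>m\<close>. For infinite index, all terms are bounded by the one at the maximum, and a
  factor larger than the number of terms is absorbed by rapid growth.\<close>

lemma eventually_sum_less:
  assumes c: "logistic_tail \<theta> x J < c"
  shows "eventually (\<lambda>s. (\<Sum>i\<in>J. f (x i * s)) < f (c * s)) (at_right 0)"
proof (cases "\<theta> = \<infinity>")
  case False
  then obtain r where r: "\<theta> = ereal r" "1 \<le> r"
    "((\<lambda>s. (\<Sum>i\<in>J. f (x i * s)) / f s) \<longlongrightarrow> logistic_tail \<theta> x J powr r) (at_right 0)"
    by (rule finite_index)
  have "0 < c" using c logistic_tail_nonneg by linarith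
  have "logistic_tail \<theta> x J powr r < c powr r"
    using c r(2) logistic_tail_nonneg by (intro powr_less_mono2) auto
  then obtain m where m: "logistic_tail \<theta> x J powr r < m" "m < c powr r"
    using dense by blast
  have "eventually (\<lambda>s. 0 < f s) (at_right 0)" using eventually_pos[of 1] by simp
  with order_tendstoD(2)[OF r(3) m(1)] order_tendstoD(1)[OF tendsto_ratio[OF r(1) \<open>0 < c\<close>] m(2)]
  show ?thesis
  proof eventually_elim
    case (elim s)
    from elim(1,2) have "(\<Sum>i\<in>J. f (x i * s)) / f s < f (c * s) / f s" by (rule less_trans)
    with elim(3) show ?case by (simp add: divide_less_cancel)
  qed
next
  case True
  define m where "m = Max (x ` J)"
  have "m \<in> x ` J" unfolding m_def using J by (intro Max_in) auto
  then have m: "0 < m" using x by auto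
  have le_m: "x i \<le> m" if "i \<in> J" for i using that J unfolding m_def by auto
  have "1 < c / m" using c True m by (simp add: logistic_tail_def m_def)
  \<comment> \<open>The extra \<open>1\<close> beyond \<open>card J\<close> makes the final
    comparison strict, as \<open>f (m * s)\<close> is positive.\<close>
  from eventually_mult_le_if_infinite_index[OF True this]
  have "eventually (\<lambda>s. (real (card J) + 1) * f (m * s) \<le> f (c / m * (m * s))) (at_right 0)"
    by (rule eventually_compose_filterlim[OF _ filterlim_mult_at_right_0[OF m]])
  moreover have "eventually (\<lambda>s. \<forall>i\<in>J. f (x i * s) \<le> f (m * s)) (at_right 0)"
    using J x le_m by (intro eventually_ball_finite ballI eventually_mult_mono) auto
  ultimately show ?thesis using eventually_pos[OF m]
  proof eventually_elim
    case (elim s)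
    then have "(\<Sum>i\<in>J. f (x i * s)) \<le> real (card J) * f (m * s)"
      by (intro sum_bounded_above) auto
    also have "\<dots> < f (c * s)"
      using elim m by (simp add: algebra_simps)
    finally show ?case .
  qed
qed

text \<open>For infinite index a single term, the one attaining the maximum, already dominates
  \<open>f (c * s)\<close> by monotonicity.\<close>

lemma eventually_le_sum:
  assumes c: "0 < c" "c < logistic_tail \<theta> x J"
  shows "eventually (\<lambda>s. f (c * s) \<le> (\<Sum>i\<in>J. f (x i * s))) (at_right 0)"
proof (cases "\<theta> = \<infinity>")
  case False
  then obtain r where r: "\<theta> = ereal r" "1 \<le> r"
    "((\<lambda>s. (\<Sum>i\<in>J. f (x i * s)) / f s) \<longlongrightarrow> logistic_tail \<theta> x J powr r) (at_right 0)"
    by (rule finite_index)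
  have "c powr r < logistic_tail \<theta> x J powr r"
    using c r(2) by (intro powr_less_mono2) auto
  then obtain m where m: "c powr r < m" "m < logistic_tail \<theta> x J powr r"
    using dense by blast
  have "eventually (\<lambda>s. 0 < f s) (at_right 0)" using eventually_pos[of 1] by simp
  with order_tendstoD(2)[OF tendsto_ratio[OF r(1) c(1)] m(1)] order_tendstoD(1)[OF r(3) m(2)]
  show ?thesis
  proof eventually_elim
    case (elim s)
    from elim(1,2) have "f (c * s) / f s < (\<Sum>i\<in>J. f (x i * s)) / f s" by (rule less_trans)
    with elim(3) show ?case by (simp add: divide_less_cancel)
  qed
next
  case True
  have "Max (x ` J) \<in> x ` J" using J by (intro Max_in) auto
  then obtain j where j: "j \<in> J" "logistic_tail \<theta> x J = x j"
    using True by (auto simp: logistic_tail_def)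
  have "eventually (\<lambda>s. f (c * s) \<le> f (x j * s)) (at_right 0)"
    using c j by (intro eventually_mult_mono) auto
  moreover have "eventually (\<lambda>s. \<forall>i\<in>J. 0 < f (x i * s)) (at_right 0)"
    using J x by (intro eventually_ball_finite ballI eventually_pos) auto
  ultimately show ?thesis
  proof eventually_elim
    case (elim s)
    have "f (x j * s) \<le> (\<Sum>i\<in>J. f (x i * s))"
      using elim(2) j(1) J by (intro member_le_sum) (auto intro: less_imp_le)
    with elim(1) show ?case by simp
  qed
qed

end

end

section \<open>Archimedean generators\<close>

lemma generalized_inverse_le:
  assumes "t \<in> {0..1}" "\<phi> t \<le> y"
  shows "generalized_inverse \<phi> y \<le> t"
  unfolding generalized_inverse_def using assms by (intro cInf_lower bdd_belowI[of _ 0]) auto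

text \<open>By antitonicity no point left of \<open>t\<close> can have a value at most
  \<open>y\<close>. The condition \<open>\<phi> 1 \<le> y\<close> makes the set under the infimum
  nonempty.\<close>

lemma generalized_inverse_ge:
  assumes "antimono_on {0..1} \<phi>" "\<phi> 1 \<le> y" "t \<in> {0..1}" "y < \<phi> t"
  shows "t \<le> generalized_inverse \<phi> y"
  unfolding generalized_inverse_def
proof (intro cInf_greatest)
  fix u assume u: "u \<in> {t \<in> {0..1}. \<phi> t \<le> y}"
  show "t \<le> u"
  proof (rule ccontr)
    assume "\<not> t \<le> u"
    then have "\<phi> t \<le> \<phi> u" using u assms(1,3) by (intro monotone_onD[OF assms(1)]) auto
    with u assms(4) show False by auto
  qed
qed (use assms in auto)

lemma generator_finite:
  assumes "\<phi> 1 = 0" "nondecreasing_derivative \<phi> \<phi>'" "0 < t" "t \<le> 1"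
  shows "\<phi> t = ereal (real_of_ereal (\<phi> t))"
proof -
  have "\<phi> 1 - \<phi> t = ereal (LBINT u:{t..1}. \<phi>' u)"
    using assms unfolding nondecreasing_derivative_def by blast
  then show ?thesis using assms(1) by (cases "\<phi> t") auto
qed

text \<open>The integral of the nondecreasing \<open>\<phi>'\<close> lies between the constants
  given by its endpoint values. The bound \<open>b < 1\<close> stays inside the open interval of
  monotonicity.\<close>

lemma generator_increment:
  assumes "\<phi> 1 = 0" and deriv: "nondecreasing_derivative \<phi> \<phi>'"
    and "0 < a" "a \<le> b" "b < 1"
  shows "\<phi>' a * (b - a) \<le> real_of_ereal (\<phi> b) - real_of_ereal (\<phi> a)"
    and "real_of_ereal (\<phi> b) - real_of_ereal (\<phi> a) \<le> \<phi>' b * (b - a)"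
proof -
  have int: "set_integrable lborel {a..b} \<phi>'" and "\<phi> b - \<phi> a = ereal (LBINT u:{a..b}. \<phi>' u)"
    using assms unfolding nondecreasing_derivative_def by auto
  then have eq: "real_of_ereal (\<phi> b) - real_of_ereal (\<phi> a) = (LBINT u:{a..b}. \<phi>' u)"
    using generator_finite[OF assms(1,2), of a] generator_finite[OF assms(1,2), of b] assms
    by (metis ereal_minus(1) ereal.inject less_le_trans le_less_trans less_imp_le)
  have mono: "\<phi>' u \<le> \<phi>' v" if "a \<le> u" "u \<le> v" "v \<le> b" for u v
    using deriv that assms unfolding nondecreasing_derivative_def by (auto intro: mono_onD)
  have const: "set_integrable lborel {a..b} (\<lambda>_. c)" "(LBINT u:{a..b}. c) = c * (b - a)" for c :: real
    using assms by (auto simp: set_integrable_def set_lebesgue_integral_def)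
  show "\<phi>' a * (b - a) \<le> real_of_ereal (\<phi> b) - real_of_ereal (\<phi> a)"
    unfolding eq const(2)[symmetric] by (intro set_integral_mono const int mono) auto
  show "real_of_ereal (\<phi> b) - real_of_ereal (\<phi> a) \<le> \<phi>' b * (b - a)"
    unfolding eq const(2)[symmetric] by (intro set_integral_mono const int mono) auto
qed

section \<open>Strict monotonicity and inversion of the generator of a copula\<close>

lemma copula_at_ones:
  assumes "copula d C"
  shows "C (\<lambda>_. 1) = 1"
proof -
  obtain P where P: "prob_space P" "sets P = sets (\<Pi>\<^sub>M i\<in>{1..d}. (borel :: real measure))"
      "has_distribution_function P d (\<lambda>i v. v i) C"
      "\<And>i. i \<in> {1..d} \<Longrightarrow> distr P borel (\<lambda>v. v i) = uniform_measure lborel {0<..<1}"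
    using assms unfolding copula_def by blast
  interpret P: prob_space P by fact
  \<comment> \<open>Uniform margins keep every component at most \<open>1\<close> almost surely, so
    the event at the all-ones point has full probability.\<close>
  have "AE v in P. v i \<le> 1" if i: "i \<in> {1..d}" for i
  proof -
    have meas: "(\<lambda>v. v i) \<in> borel_measurable P"
      using P(3) i unfolding has_distribution_function_def by blast
    have "AE u in uniform_measure lborel {0<..<1::real}. u \<le> 1"
      by (rule AE_uniform_measureI) auto
    then have "AE u in distr P borel (\<lambda>v. v i). u \<le> 1" unfolding P(4)[OF i] .
    then show ?thesis using meas by (subst (asm) AE_distr_iff) auto
  qed
  then have "AE v in P. \<forall>i\<in>{1..d}. v i \<le> 1" by (intro AE_finite_allI) auto
  moreover have "{v \<in> space P. \<forall>i\<in>{1..d}. v i \<le> 1} \<in> sets P"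
  proof (rule sets.sets_Collect_finite_All)
    fix i assume "i \<in> {1..d}"
    then have "(\<lambda>v. v i) \<in> borel_measurable P"
      using P(3) unfolding has_distribution_function_def by blast
    then show "{v \<in> space P. v i \<le> 1} \<in> sets P" by measurable
  qed auto
  ultimately have "\<P>(v in P. \<forall>i\<in>{1..d}. v i \<le> 1) = 1" by (simp add: P.prob_Collect_eq_1)
  then show ?thesis
    using P(3) unfolding has_distribution_function_def by (auto dest!: bspec[of _ _ "\<lambda>_. 1"])
qed

text \<open>The value of the copula at the all-ones point forces
  \<open>generalized_inverse \<phi> 0 = 1\<close>, whereas a zero of \<open>\<phi>\<close> at
  \<open>t < 1\<close> would push this infimum down to \<open>t\<close>.\<close>

lemma generator_pos:
  assumes "archimedean_generator \<phi>" "copula d (archimedean_function d \<phi>)" "0 \<le> t" "t < 1"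
  shows "0 < \<phi> t"
proof (rule ccontr)
  assume "\<not> 0 < \<phi> t"
  then have "generalized_inverse \<phi> 0 \<le> t" using assms(3,4) by (intro generalized_inverse_le) auto
  moreover have "generalized_inverse \<phi> 0 = 1"
    using copula_at_ones[OF assms(2)] assms(1)
    by (simp add: archimedean_function_def archimedean_generator_def)
  ultimately show False using assms(4) by simp
qed

text \<open>Convexity between \<open>t\<close> and \<open>1\<close>, where \<open>\<phi>\<close>
  vanishes, shrinks \<open>\<phi> t\<close> by the factor \<open>1 - w\<close>. This is a strict
  decrease because \<open>\<phi> t\<close> is positive and finite.\<close>

lemma generator_strict:
  assumes gen: "archimedean_generator \<phi>" and C: "copula d (archimedean_function d \<phi>)"
    and deriv: "nondecreasing_derivative \<phi> \<phi>'" and t: "0 < t" "t < u" "u \<le> 1"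
  shows "\<phi> u < \<phi> t"
proof -
  define w where "w = (u - t) / (1 - t)"
  have w: "0 < w" "w \<le> 1" using t by (auto simp: w_def)
  have "w * (1 - t) = u - t" using t by (simp add: w_def)
  then have u: "u = (1 - w) * t + w * 1" by (simp add: algebra_simps)
  have "\<phi> ((1 - w) * t + w * 1) \<le> ereal (1 - w) * \<phi> t + ereal w * \<phi> 1"
  proof -
    have "\<forall>a\<in>{0..1}. \<forall>b\<in>{0..1}. \<forall>v\<in>{0..1}.
        \<phi> ((1 - v) * a + v * b) \<le> ereal (1 - v) * \<phi> a + ereal v * \<phi> b"
      using gen unfolding archimedean_generator_def by blast
    moreover have "t \<in> {0..1}" "w \<in> {0..1}" "(1::real) \<in> {0..1}" using t w by auto
    ultimately show ?thesis by blast
  qed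
  also have "\<dots> = ereal (1 - w) * \<phi> t" using gen by (simp add: archimedean_generator_def)
  also have "\<dots> < \<phi> t"
  proof -
    have "\<phi> 1 = 0" using gen by (simp add: archimedean_generator_def)
    from generator_finite[OF this deriv, of t] obtain r where r: "\<phi> t = ereal r"
      using t by auto
    then have "0 < r" using generator_pos[OF gen C, of t] t by simp
    then show ?thesis using w(1) by (simp add: r)
  qed
  finally show ?thesis by (simp only: u[symmetric])
qed

text \<open>By strictness every \<open>u < t\<close> has a larger value than \<open>t\<close>, hence
  is a lower bound for the infimum; then \<open>u\<close> tends to \<open>t\<close>.\<close>

lemma generalized_inverse_generator:
  assumes gen: "archimedean_generator \<phi>" and C: "copula d (archimedean_function d \<phi>)"
    and deriv: "nondecreasing_derivative \<phi> \<phi>'" and t: "0 < t" "t \<le> 1"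
  shows "generalized_inverse \<phi> (\<phi> t) = t"
proof (rule antisym)
  show "t \<le> generalized_inverse \<phi> (\<phi> t)"
  proof (rule dense_le_bounded)
    show "0 < t" by fact
    fix u assume u: "0 < u" "u < t"
    with gen t generator_strict[OF gen C deriv, of u t] show "u \<le> generalized_inverse \<phi> (\<phi> t)"
      by (intro generalized_inverse_ge) (auto simp: archimedean_generator_def)
  qed
qed (use t in \<open>auto intro: generalized_inverse_le\<close>)

section \<open>Asymptotics of the generalized inverse at sums of generator values\<close>

lemma power_growth_generator:
  assumes gen: "archimedean_generator \<phi>" and C: "copula d (archimedean_function d \<phi>)"
    and deriv: "nondecreasing_derivative \<phi> \<phi>'" and "1 \<le> \<theta>"
    and lim: "((\<lambda>s. ereal (s * \<phi>' (1 - s)) / \<phi> (1 - s)) \<longlongrightarrow> - \<theta>) (at_right 0)"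
  shows "power_growth (\<lambda>s. real_of_ereal (\<phi> (1 - s))) (\<lambda>s. - \<phi>' (1 - s)) \<theta>"
proof
  have phi1: "\<phi> 1 = 0" using gen by (simp add: archimedean_generator_def)
  note fin = generator_finite[OF phi1 deriv]
  fix a b :: real assume ab: "0 < a" "a \<le> b" "b < 1"
  \<comment> \<open>The reflection \<open>s \<mapsto> 1 - s\<close> swaps the endpoints, so the
    upper increment bound for \<open>\<phi>\<close> becomes the lower one here, and
    conversely.\<close>
  show "- \<phi>' (1 - a) * (b - a) \<le> real_of_ereal (\<phi> (1 - b)) - real_of_ereal (\<phi> (1 - a))"
    using generator_increment(2)[OF phi1 deriv, of "1 - b" "1 - a"] ab by (simp add: algebra_simps)
  show "real_of_ereal (\<phi> (1 - b)) - real_of_ereal (\<phi> (1 - a)) \<le> - \<phi>' (1 - b) * (b - a)"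
    using generator_increment(1)[OF phi1 deriv, of "1 - b" "1 - a"] ab by (simp add: algebra_simps)
  have "\<phi> (1 - a) \<le> \<phi> (1 - b)"
    using gen ab by (auto simp: archimedean_generator_def intro: monotone_onD)
  then show "real_of_ereal (\<phi> (1 - a)) \<le> real_of_ereal (\<phi> (1 - b))"
    using fin[of "1 - a"] fin[of "1 - b"] ab
    by (cases "\<phi> (1 - a)"; cases "\<phi> (1 - b)") auto
next
  fix s :: real assume s: "0 < s" "s < 1"
  show "0 < real_of_ereal (\<phi> (1 - s))"
    using generator_pos[OF gen C, of "1 - s"] generator_finite[OF _ deriv, of "1 - s"] gen s
    by (cases "\<phi> (1 - s)") (auto simp: archimedean_generator_def)
next
  have 1: "((\<lambda>s. - (ereal (s * \<phi>' (1 - s)) / \<phi> (1 - s))) \<longlongrightarrow> - (- \<theta>)) (at_right 0)"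
    by (intro tendsto_uminus_ereal lim)
  \<comment> \<open>Near \<open>0\<close> the value \<open>\<phi> (1 - s)\<close> is positive and
    finite, so the extended quotient is the real one.\<close>
  have 2: "eventually (\<lambda>s. - (ereal (s * \<phi>' (1 - s)) / \<phi> (1 - s))
      = ereal (s * - \<phi>' (1 - s) / real_of_ereal (\<phi> (1 - s)))) (at_right 0)"
  proof -
    have "eventually (\<lambda>s::real. 0 < s \<and> s < 1) (at_right 0)"
      using eventually_at_right_real[of 0 1] by simp
    then show ?thesis
    proof eventually_elim
      case (elim s)
      have "0 < \<phi> (1 - s)" using generator_pos[OF gen C, of "1 - s"] elim by simp
      moreover have "\<phi> (1 - s) = ereal (real_of_ereal (\<phi> (1 - s)))"
        using gen elim by (intro generator_finite[OF _ deriv]) (auto simp: archimedean_generator_def)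
      ultimately show ?case by (cases "\<phi> (1 - s)") auto
    qed
  qed
  show "((\<lambda>s. ereal (s * - \<phi>' (1 - s) / real_of_ereal (\<phi> (1 - s)))) \<longlongrightarrow> \<theta>) (at_right 0)"
    by (rule Lim_transform_eventually[OF 1[unfolded ereal_uminus_uminus] 2])
qed fact

text \<open>Bounding the quotient by a constant \<open>c\<close> means comparing the generalized
  inverse with \<open>1 - c * s\<close>, and this follows from comparing the sum with
  \<open>\<phi> (1 - c * s) = f (c * s)\<close>.\<close>

lemma tendsto_generalized_inverse_sum:
  assumes gen: "archimedean_generator \<phi>" and C: "copula d (archimedean_function d \<phi>)"
    and deriv: "nondecreasing_derivative \<phi> \<phi>'" and "1 \<le> \<theta>"
    and lim: "((\<lambda>s. ereal (s * \<phi>' (1 - s)) / \<phi> (1 - s)) \<longlongrightarrow> - \<theta>) (at_right 0)"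
    and J: "finite J" "J \<noteq> {}" and x: "\<forall>i\<in>J. 0 < x i"
  shows "((\<lambda>s. (1 - generalized_inverse \<phi> (\<Sum>i\<in>J. \<phi> (1 - s * x i))) / s)
    \<longlongrightarrow> logistic_tail \<theta> x J) (at_right 0)"
proof -
  define f where "f = (\<lambda>s. real_of_ereal (\<phi> (1 - s)))"
  interpret power_growth f "\<lambda>s. - \<phi>' (1 - s)" \<theta>
    unfolding f_def by (rule power_growth_generator[OF assms(1-5)])
  have phi1: "\<phi> 1 = 0" and anti: "antimono_on {0..1} \<phi>"
    using gen by (auto simp: archimedean_generator_def)
  have phi_f: "\<phi> (1 - s) = ereal (f s)" if "0 < s" "s < 1" for s
    unfolding f_def using that by (intro generator_finite[OF phi1 deriv]) auto
  have ev_x: "eventually (\<lambda>s. 0 < s \<and> s * c < 1) (at_right 0)" if "0 < c" for c :: real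
    using eventually_at_right_real[of 0 "1 / c"] that by (simp add: field_simps)
  have ev_sum: "eventually (\<lambda>s. (\<Sum>i\<in>J. \<phi> (1 - s * x i)) = ereal (\<Sum>i\<in>J. f (x i * s))) (at_right 0)"
  proof -
    have "eventually (\<lambda>s. \<forall>i\<in>J. 0 < s \<and> s * x i < 1) (at_right 0)"
      using J x by (intro eventually_ball_finite ballI ev_x) auto
    then show ?thesis
    proof eventually_elim
      case (elim s)
      then have "(\<Sum>i\<in>J. \<phi> (1 - s * x i)) = (\<Sum>i\<in>J. ereal (f (x i * s)))"
        using x by (intro sum.cong) (auto simp: phi_f mult.commute[of s])
      then show ?case by simp
    qed
  qed
  have sum_nonneg: "eventually (\<lambda>s. 0 \<le> (\<Sum>i\<in>J. f (x i * s))) (at_right 0)"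
  proof -
    have "eventually (\<lambda>s. \<forall>i\<in>J. 0 < f (x i * s)) (at_right 0)"
      using J x by (intro eventually_ball_finite ballI eventually_pos) auto
    then show ?thesis by eventually_elim (auto intro: sum_nonneg less_imp_le)
  qed
  show ?thesis
  proof (rule order_tendstoI)
    fix a assume a: "logistic_tail \<theta> x J < a"
    then obtain c where c: "logistic_tail \<theta> x J < c" "c < a" using dense by blast
    have "0 < c" using logistic_tail_nonneg[OF J x] c(1) by linarith
    from eventually_sum_less[OF J x c(1)] ev_sum sum_nonneg ev_x[OF \<open>0 < c\<close>]
    show "eventually (\<lambda>s. (1 - generalized_inverse \<phi> (\<Sum>i\<in>J. \<phi> (1 - s * x i))) / s < a) (at_right 0)"
    proof eventually_elim
      case (elim s)
      have "1 - c * s \<le> generalized_inverse \<phi> (\<Sum>i\<in>J. \<phi> (1 - s * x i))"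
        using elim \<open>0 < c\<close> phi_f[of "c * s"] phi1
        by (intro generalized_inverse_ge[OF anti]) (auto simp: mult.commute)
      then have "(1 - generalized_inverse \<phi> (\<Sum>i\<in>J. \<phi> (1 - s * x i))) / s \<le> c"
        using elim by (simp add: field_simps)
      with c(2) show ?case by linarith
    qed
  next
    fix a assume a: "a < logistic_tail \<theta> x J"
    show "eventually (\<lambda>s. a < (1 - generalized_inverse \<phi> (\<Sum>i\<in>J. \<phi> (1 - s * x i))) / s) (at_right 0)"
    proof (cases "a < 0")
      case True
      \<comment> \<open>No positive \<open>c\<close> need be chosen here: the inverse is at most
        \<open>1\<close>, so the quotient is nonnegative.\<close>
      from ev_sum sum_nonneg ev_x[OF zero_less_one] show ?thesis
      proof eventually_elim
        case (elim s)
        then have "generalized_inverse \<phi> (\<Sum>i\<in>J. \<phi> (1 - s * x i)) \<le> 1"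
          by (intro generalized_inverse_le) (auto simp: phi1)
        then have "0 \<le> (1 - generalized_inverse \<phi> (\<Sum>i\<in>J. \<phi> (1 - s * x i))) / s"
          using elim by simp
        with True show ?case by linarith
      qed
    next
      case False
      obtain c where c: "a < c" "c < logistic_tail \<theta> x J" using a dense by blast
      with False have "0 < c" by simp
      from eventually_le_sum[OF J x \<open>0 < c\<close> c(2)] ev_sum ev_x[OF \<open>0 < c\<close>] show ?thesis
      proof eventually_elim
        case (elim s)
        have "generalized_inverse \<phi> (\<Sum>i\<in>J. \<phi> (1 - s * x i)) \<le> 1 - c * s"
          using elim \<open>0 < c\<close> phi_f[of "c * s"]
          by (intro generalized_inverse_le) (auto simp: mult.commute)
        then have "c \<le> (1 - generalized_inverse \<phi> (\<Sum>i\<in>J. \<phi> (1 - s * x i))) / s"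
          using elim by (simp add: field_simps)
        with c(1) show ?case by linarith
      qed
    qed
  qed
qed

section \<open>Joint survival probabilities\<close>

locale archimedean_vector = prob_space M
  for M :: "'a measure" +
  fixes d :: nat and \<phi> :: "real \<Rightarrow> ereal" and U :: "nat \<Rightarrow> 'a \<Rightarrow> real"
  assumes gen: "archimedean_generator \<phi>"
    and C: "copula d (archimedean_function d \<phi>)"
    and df: "has_distribution_function M d U (archimedean_function d \<phi>)"
begin

lemma measurable_component: "i \<in> {1..d} \<Longrightarrow> U i \<in> borel_measurable M"
  using df unfolding has_distribution_function_def by blast

text \<open>Coordinates outside \<open>J\<close> are set to \<open>1\<close>: this changes the event
  by a null set, and their terms vanish since \<open>\<phi> 1 = 0\<close>.\<close>

lemma prob_all_le:
  assumes J: "J \<subseteq> {1..d}" and u: "\<And>i. i \<in> J \<Longrightarrow> u i \<in> {0..1}"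
  shows "\<P>(\<omega> in M. \<forall>i\<in>J. U i \<omega> \<le> u i) = generalized_inverse \<phi> (\<Sum>i\<in>J. \<phi> (u i))"
proof -
  have [measurable]: "Measurable.pred M (\<lambda>\<omega>. \<forall>i\<in>K. U i \<omega> \<le> w i)" if "K \<subseteq> {1..d}" for K w
    using that finite_subset[OF that] measurable_component by (intro pred_intros_finite) auto
  have df': "\<P>(\<omega> in M. \<forall>i\<in>{1..d}. U i \<omega> \<le> w i) = archimedean_function d \<phi> w"
    if "\<And>i. i \<in> {1..d} \<Longrightarrow> w i \<in> {0..1}" for w
    using df that unfolding has_distribution_function_def by blast
  have "\<P>(\<omega> in M. \<forall>i\<in>{1..d}. U i \<omega> \<le> 1) = 1"
    using df'[of "\<lambda>_. 1"] copula_at_ones[OF C] by simp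
  then have le_1: "AE \<omega> in M. \<forall>i\<in>{1..d}. U i \<omega> \<le> 1"
    by (subst (asm) prob_Collect_eq_1) measurable
  define w where "w = (\<lambda>i. if i \<in> J then u i else 1)"
  have "\<P>(\<omega> in M. \<forall>i\<in>J. U i \<omega> \<le> u i) = \<P>(\<omega> in M. \<forall>i\<in>{1..d}. U i \<omega> \<le> w i)"
  proof (rule prob_eq_AE)
    show "AE \<omega> in M. (\<forall>i\<in>J. U i \<omega> \<le> u i) \<longleftrightarrow> (\<forall>i\<in>{1..d}. U i \<omega> \<le> w i)"
      using le_1 by eventually_elim (use J in \<open>auto simp: w_def\<close>)
  qed (use J in measurable)
  also have "\<dots> = generalized_inverse \<phi> (\<Sum>i\<in>{1..d}. \<phi> (w i))"
    using u by (subst df') (auto simp: w_def archimedean_function_def)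
  also have "(\<Sum>i\<in>{1..d}. \<phi> (w i)) = (\<Sum>i\<in>J. \<phi> (u i))"
    using J gen by (intro sum.mono_neutral_cong_right) (auto simp: w_def archimedean_generator_def)
  finally show ?thesis .
qed

text \<open>On the open unit interval the margin satisfies \<open>Pr[U i \<le> u] = u\<close>, so an
  atom at \<open>t\<close> has mass at most \<open>t - v\<close> for each
  \<open>v < t\<close>.\<close>

lemma AE_component_neq:
  assumes deriv: "nondecreasing_derivative \<phi> \<phi>'" and i: "i \<in> {1..d}" and t: "0 < t" "t < 1"
  shows "AE \<omega> in M. U i \<omega> \<noteq> t"
proof -
  note [measurable] = measurable_component[OF i]
  have le: "\<P>(\<omega> in M. U i \<omega> \<le> u) = u" if "0 < u" "u < 1" for u
    using prob_all_le[of "{i}" "\<lambda>_. u"] generalized_inverse_generator[OF gen C deriv, of u] i that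
    by simp
  have "\<P>(\<omega> in M. U i \<omega> = t) \<le> 0"
  proof (rule field_le_epsilon)
    fix e :: real assume e: "0 < e"
    \<comment> \<open>This \<open>v\<close> is within \<open>e\<close> of \<open>t\<close> and stays
      positive, where the margin is known.\<close>
    define v where "v = max (t / 2) (t - e)"
    have v: "0 < v" "v < t" "t - v \<le> e" using t e by (auto simp: v_def)
    have "\<P>(\<omega> in M. U i \<omega> = t) + \<P>(\<omega> in M. U i \<omega> \<le> v)
        = prob ({\<omega> \<in> space M. U i \<omega> = t} \<union> {\<omega> \<in> space M. U i \<omega> \<le> v})"
      using v by (intro finite_measure_Union[symmetric]) auto
    also have "\<dots> \<le> \<P>(\<omega> in M. U i \<omega> \<le> t)"
      using v by (intro finite_measure_mono) auto
    finally show "\<P>(\<omega> in M. U i \<omega> = t) \<le> 0 + e"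
      using le[of t] le[of v] v t by simp
  qed
  then have "\<P>(\<omega> in M. U i \<omega> = t) = 0" using measure_nonneg[of M] by (intro antisym) auto
  then show ?thesis by (subst (asm) prob_Collect_eq_0) auto
qed

text \<open>Ties have probability zero, so weak inequalities can be made strict. The complement of a
  union of the events \<open>u i < U i\<close> is then an event given by the distribution
  function.\<close>

lemma prob_all_ge:
  assumes deriv: "nondecreasing_derivative \<phi> \<phi>'"
    and I: "I \<subseteq> {1..d}" "I \<noteq> {}" and u: "\<And>i. i \<in> I \<Longrightarrow> 0 < u i \<and> u i < 1"
  shows "\<P>(\<omega> in M. \<forall>i\<in>I. u i \<le> U i \<omega>) =
    (\<Sum>J\<in>Pow I - {{}}. (-1) ^ (card J - 1) * (1 - generalized_inverse \<phi> (\<Sum>i\<in>J. \<phi> (u i))))"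
proof -
  have fin: "finite I" using I(1) finite_subset by blast
  have u01: "u i \<in> {0..1}" if "i \<in> I" for i using u[OF that] by simp
  define A where "A = (\<lambda>i. {\<omega> \<in> space M. u i < U i \<omega>})"
  have A: "A i \<in> events" if "i \<in> I" for i
  proof -
    have [measurable]: "U i \<in> borel_measurable M" using that I(1) by (intro measurable_component) auto
    show ?thesis unfolding A_def by measurable
  qed
  have "AE \<omega> in M. \<forall>i\<in>I. U i \<omega> \<noteq> u i"
    using fin I(1) u by (intro AE_finite_allI AE_component_neq[OF deriv]) auto
  then have "\<P>(\<omega> in M. \<forall>i\<in>I. u i \<le> U i \<omega>) = prob (\<Inter>i\<in>I. A i)"
  proof (intro measure_eq_AE)
    show "{\<omega> \<in> space M. \<forall>i\<in>I. u i \<le> U i \<omega>} \<in> events"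
      using fin I(1) measurable_component by (intro sets.sets_Collect_finite_All) auto
    show "(\<Inter>i\<in>I. A i) \<in> events" using fin I(2) A by (intro sets.finite_INT) auto
    assume "AE \<omega> in M. \<forall>i\<in>I. U i \<omega> \<noteq> u i"
    then show "AE \<omega> in M. \<omega> \<in> {\<omega> \<in> space M. \<forall>i\<in>I. u i \<le> U i \<omega>} \<longleftrightarrow> \<omega> \<in> (\<Inter>i\<in>I. A i)"
    proof eventually_elim
      case (elim \<omega>)
      then have "u i \<le> U i \<omega> \<longleftrightarrow> u i < U i \<omega>" if "i \<in> I" for i using that by force
      then show ?case using I(2) by (auto simp: A_def)
    qed
  qed
  also have "\<dots> = (\<Sum>J\<in>Pow I - {{}}. (-1) ^ (card J - 1) * prob (\<Union>i\<in>J. A i))"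
    using fin I(2) A sets.ring_of_sets_axioms
    by (intro dual_inclusion_exclusion[symmetric] finite_measure_Union) auto
  also have "\<dots> = (\<Sum>J\<in>Pow I - {{}}. (-1) ^ (card J - 1) *
      (1 - generalized_inverse \<phi> (\<Sum>i\<in>J. \<phi> (u i))))"
  proof (intro sum.cong refl arg_cong2[where f = "(*)"])
    fix J assume J: "J \<in> Pow I - {{}}"
    then have "finite J" using fin finite_subset by auto
    with J A have "(\<Union>i\<in>J. A i) \<in> events" by (intro sets.finite_UN) auto
    then have "prob (\<Union>i\<in>J. A i) = 1 - prob (space M - (\<Union>i\<in>J. A i))"
      by (simp add: prob_compl)
    also have "space M - (\<Union>i\<in>J. A i) = {\<omega> \<in> space M. \<forall>i\<in>J. U i \<omega> \<le> u i}"
      by (auto simp: A_def not_less)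
    also have "prob \<dots> = generalized_inverse \<phi> (\<Sum>i\<in>J. \<phi> (u i))"
      using J I(1) u01 by (intro prob_all_le) auto
    finally show "prob (\<Union>i\<in>J. A i) = 1 - generalized_inverse \<phi> (\<Sum>i\<in>J. \<phi> (u i))" .
  qed
  finally show ?thesis .
qed

end

section \<open>Termwise limit of the inclusion-exclusion formula and its value in the three
  cases\<close>

theorem theorem4p1:
  fixes d :: nat and \<phi> :: "real \<Rightarrow> ereal" and \<phi>' :: "real \<Rightarrow> real"
    and M :: "'a measure" and U :: "nat \<Rightarrow> 'a \<Rightarrow> real"
    and \<theta>\<^sub>1 :: ereal and I :: "nat set" and x :: "nat \<Rightarrow> real"
  assumes "2 \<le> d"
    and "archimedean_generator \<phi>"
    and "copula d (archimedean_function d \<phi>)"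
    and "nondecreasing_derivative \<phi> \<phi>'"
    and "prob_space M"
    and "has_distribution_function M d U (archimedean_function d \<phi>)"
    and "1 \<le> \<theta>\<^sub>1"
    and "((\<lambda>s. ereal (s * \<phi>' (1 - s)) / \<phi> (1 - s)) \<longlongrightarrow> - \<theta>\<^sub>1) (at_right 0)"
    and "I \<subseteq> {1..d}"
    and "2 \<le> card I"
    and "\<forall>i\<in>I. 0 < x i"
  shows "((\<lambda>s. (1 / s) * \<P>(\<omega> in M. \<forall>i\<in>I. U i \<omega> \<ge> 1 - s * x i)) \<longlongrightarrow>
           (if \<theta>\<^sub>1 = 1 then 0
            else if \<theta>\<^sub>1 < \<infinity> then
              (\<Sum>J\<in>Pow I - {{}}. (-1) ^ (card J - 1) *
                 (\<Sum>i\<in>J. x i powr real_of_ereal \<theta>\<^sub>1) powr (1 / real_of_ereal \<theta>\<^sub>1))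
            else Min (x ` I))) (at_right 0)"
proof -
  interpret archimedean_vector M d \<phi> U
    using assms by (simp add: archimedean_vector_def archimedean_vector_axioms_def)
  have fin: "finite I" using assms(9) finite_subset by blast
  have ne: "I \<noteq> {}" using assms(10) by auto
  have "((\<lambda>s. \<Sum>J\<in>Pow I - {{}}. (-1) ^ (card J - 1) *
      ((1 - generalized_inverse \<phi> (\<Sum>i\<in>J. \<phi> (1 - s * x i))) / s))
      \<longlongrightarrow> (\<Sum>J\<in>Pow I - {{}}. (-1) ^ (card J - 1) * logistic_tail \<theta>\<^sub>1 x J)) (at_right 0)"
    using fin assms(11) finite_subset[OF _ fin]
    by (intro tendsto_sum tendsto_mult tendsto_const
        tendsto_generalized_inverse_sum[OF gen C assms(4,7,8)]) auto
  moreover have "eventually (\<lambda>s. (\<Sum>J\<in>Pow I - {{}}. (-1) ^ (card J - 1) *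
      ((1 - generalized_inverse \<phi> (\<Sum>i\<in>J. \<phi> (1 - s * x i))) / s))
      = (1 / s) * \<P>(\<omega> in M. \<forall>i\<in>I. U i \<omega> \<ge> 1 - s * x i)) (at_right 0)"
  proof -
    \<comment> \<open>For such \<open>s\<close> every threshold \<open>1 - s * x i\<close> lies
      strictly between \<open>0\<close> and \<open>1\<close>, so the inclusion-exclusion formula is
      exact.\<close>
    have "eventually (\<lambda>s. \<forall>i\<in>I. 0 < s \<and> s < 1 / x i) (at_right 0)"
      using fin assms(11) eventually_at_right_real[of 0]
      by (intro eventually_ball_finite ballI) auto
    then show ?thesis
    proof eventually_elim
      case (elim s)
      then have "0 < 1 - s * x i \<and> 1 - s * x i < 1" if "i \<in> I" for i
        using assms(11) that by (auto simp: field_simps)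
      from prob_all_ge[OF assms(4,9) ne this] show ?case
        by (simp add: sum_distrib_left)
    qed
  qed
  ultimately have "((\<lambda>s. (1 / s) * \<P>(\<omega> in M. \<forall>i\<in>I. U i \<omega> \<ge> 1 - s * x i)) \<longlongrightarrow>
      (\<Sum>J\<in>Pow I - {{}}. (-1) ^ (card J - 1) * logistic_tail \<theta>\<^sub>1 x J)) (at_right 0)"
    by (rule Lim_transform_eventually)
  also have "(\<Sum>J\<in>Pow I - {{}}. (-1) ^ (card J - 1) * logistic_tail \<theta>\<^sub>1 x J) =
      (if \<theta>\<^sub>1 = 1 then 0
       else if \<theta>\<^sub>1 < \<infinity> then
         (\<Sum>J\<in>Pow I - {{}}. (-1) ^ (card J - 1) *
            (\<Sum>i\<in>J. x i powr real_of_ereal \<theta>\<^sub>1) powr (1 / real_of_ereal \<theta>\<^sub>1))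
       else Min (x ` I))"
  proof -
    consider "\<theta>\<^sub>1 = 1" | "\<theta>\<^sub>1 \<noteq> 1" "\<theta>\<^sub>1 < \<infinity>" | "\<not> \<theta>\<^sub>1 < \<infinity>" by blast
    then show ?thesis
    proof cases
      case 1
      \<comment> \<open>At index \<open>1\<close> the norm is additive in \<open>J\<close>, and
        \<open>card I \<ge> 2\<close> makes the alternating sum cancel.\<close>
      have "logistic_tail \<theta>\<^sub>1 x J = (\<Sum>i\<in>J. x i)" if "J \<in> Pow I - {{}}" for J
      proof -
        have "0 \<le> (\<Sum>i\<in>J. x i)" using that assms(11) by (intro sum_nonneg) (auto intro: less_imp_le)
        moreover have "(\<Sum>i\<in>J. x i powr 1) = (\<Sum>i\<in>J. x i)"
          using that assms(11) by (intro sum.cong) (auto simp: less_imp_le)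
        ultimately show ?thesis using 1 by (simp add: logistic_tail_def)
      qed
      then have "(\<Sum>J\<in>Pow I - {{}}. (-1) ^ (card J - 1) * logistic_tail \<theta>\<^sub>1 x J)
          = (\<Sum>J\<in>Pow I - {{}}. (-1) ^ (card J - 1) * (\<Sum>i\<in>J. x i))"
        by (intro sum.cong) auto
      then show ?thesis using 1 alternating_sum_sum[OF fin assms(10), of x] by simp
    next
      case 2
      then show ?thesis by (simp add: logistic_tail_def)
    next
      case 3
      then show ?thesis
        using alternating_sum_Max[OF fin ne, of x] assms(11) by (auto simp: logistic_tail_def)
    qed
  qed
  finally show ?thesis .
qed

end
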